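(* Let $M$ be an invertible $3\times3$ complex matrix and let $\mathcal{S}$ be a smooth $M$-admissible strongly $\mathbb{C}$-convex hypersurface in $\mathbb{C}^2$. Then the Leray integral $\mathbf{L}_{\mathcal{S}}f(z)$ (for functions $f$ on $\mathcal{S}$ and points $z$ for which the integral makes sense) may be written as $$\mathbf{L}_{\mathcal{S}}f(z)=\int_{\zeta\in\mathcal{S}}f(\zeta)\,\frac{\nu_M}{\big((1,w_{1,M},w_{2,M})\,M\,(1,z_1,z_2)^T\big)^2},$$ where $w_{j,M}=w_{j,M}(\zeta)$ and $$\nu_M:=\frac{1}{(2\pi i)^2}\left(\begin{pmatrix}dw_{1,M}&dw_{2,M}\end{pmatrix}\begin{pmatrix}m_{11}&m_{12}\\ m_{21}&m_{22}\end{pmatrix}\begin{pmatrix}a_2\\ -a_1\end{pmatrix}+\begin{vmatrix}m_{11}&m_{12}\\ m_{21}&m_{22}\end{vmatrix}\big(w_{2,M}\,dw_{1,M}-w_{1,M}\,dw_{2,M}\big)\right)\wedge d\zeta_1\wedge d\zeta_2 .$$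
   Context: Leray integral: if $\rho$ is a defining function for $\mathcal{S}$, $$\mathbf{L}_{\mathcal{S}}f(z)=\int_{\mathcal{S}}f(\zeta)\,\frac{1}{(2\pi i)^2}\frac{\partial\rho(\zeta)\wedge\bar\partial\partial\rho(\zeta)}{\langle\partial\rho(\zeta),\zeta-z\rangle^2},$$ where $\langle\cdot,\cdot\rangle$ is the bilinear pairing of $(1,0)$-forms with vectors; this is independent of the choice of $\rho$. Write $M=\begin{pmatrix}c_1&a_1&a_2\\ b_1&m_{11}&m_{12}\\ b_2&m_{21}&m_{22}\end{pmatrix}$ and $\Phi_M((z_1,z_2),(w_1,w_2))=(1,w_1,w_2)\,M\,(1,z_1,z_2)^T$. For a smooth real hypersurface $\mathcal{S}\subset\mathbb{C}^2$ with defining function $\rho$ put $\mu_1=\partial\rho/\partial\zeta_2$, $\mu_2=-\partial\rho/\partial\zeta_1$. $\mathcal{S}$ is $M$-admissible if for all $\zeta\in\mathcal{S}$ $$\det\begin{pmatrix}m_{11}\mu_1(\zeta)+m_{12}\mu_2(\zeta)&m_{11}\zeta_1+m_{12}\zeta_2+b_1\\ m_{21}\mu_1(\zeta)+m_{22}\mu_2(\zeta)&m_{21}\zeta_1+m_{22}\zeta_2+b_2\end{pmatrix}\ne0.$$ In that case $w_{1,M},w_{2,M}$ are the uniquely determined functions on $\mathcal{S}$ such that for each $\zeta\in\mathcal{S}$ the affine complex tangent line to $\mathcal{S}$ at $\zeta$ is $\{z\in\mathbb{C}^2:\Phi_M(z,(w_{1,M}(\zeta),w_{2,M}(\zeta)))=0\}$.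 Strong $\mathbb{C}$-convexity: a connected smooth strongly pseudoconvex real hypersurface $\mathcal{S}$ is strongly $\mathbb{C}$-convex if for each $p\in\mathcal{S}$, after an automorphism of $\mathbb{C}\mathbb{P}^2$ moving $p$ to $0$ and putting $\mathcal{S}$ near $0$ in the form $\operatorname{Im}\zeta_2=\alpha|\zeta_1|^2+\operatorname{Re}(b\zeta_1^2)+c(\operatorname{Re}\zeta_2)^2+O(\|(\zeta_1,\operatorname{Re}\zeta_2)\|^3)$ (always possible, with $\alpha,c\in\mathbb{R}$, $b\in\mathbb{C}$), the form $\alpha|\zeta_1|^2+\operatorname{Re}(b\zeta_1^2)$ is positive definite in $\zeta_1$. *)

theory Defs
  imports "HOL-Analysis.Analysis" "HOL-Library.Landau_Symbols"
begin

section \<open>Smooth functions and Wirtinger derivatives\<close>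

primrec Ck_on :: "nat \<Rightarrow> 'a::real_normed_vector set \<Rightarrow> ('a \<Rightarrow> 'b::real_normed_vector) \<Rightarrow> bool" where
  "Ck_on 0 U f \<longleftrightarrow> continuous_on U f"
| "Ck_on (Suc k) U f \<longleftrightarrow>
     (\<forall>x\<in>U. f differentiable (at x)) \<and> (\<forall>v. Ck_on k U (\<lambda>x. frechet_derivative f (at x) v))"

text \<open>Only used for open \<open>U\<close> in finite-dimensional spaces.\<close>

definition smooth_on :: "'a::real_normed_vector set \<Rightarrow> ('a \<Rightarrow> 'b::real_normed_vector) \<Rightarrow> bool" where
  "smooth_on U f \<longleftrightarrow> (\<forall>k. Ck_on k U f)"

text \<open>\<open>wirt j f = \<partial>f/\<partial>\<zeta>\<^sub>j = (\<partial>f/\<partial>x\<^sub>j - i \<partial>f/\<partial>y\<^sub>j)/2\<close> and \<open>wirt_bar j f = \<partial>f/\<partial>\<zeta>\<^sub>j\<close>-bar, for real-differentiable \<open>f\<close>.\<close>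

definition wirt :: "2 \<Rightarrow> (complex^2 \<Rightarrow> complex) \<Rightarrow> complex^2 \<Rightarrow> complex" where
  "wirt j f \<zeta> = (frechet_derivative f (at \<zeta>) (axis j 1) - \<i> * frechet_derivative f (at \<zeta>) (axis j \<i>)) / 2"

definition wirt_bar :: "2 \<Rightarrow> (complex^2 \<Rightarrow> complex) \<Rightarrow> complex^2 \<Rightarrow> complex" where
  "wirt_bar j f \<zeta> = (frechet_derivative f (at \<zeta>) (axis j 1) + \<i> * frechet_derivative f (at \<zeta>) (axis j \<i>)) / 2"


section \<open>Differential forms, as alternating functions of real tangent vectors\<close>

type_synonym form1 = "complex^2 \<Rightarrow> complex"
type_synonym form2 = "complex^2 \<Rightarrow> complex^2 \<Rightarrow> complex"
type_synonym form3 = "complex^2 \<Rightarrow> complex^2 \<Rightarrow> complex^2 \<Rightarrow> complex"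

text \<open>Determinant normalisation of the wedge product:
  \<open>(dx \<and> dy)(e\<^sub>x, e\<^sub>y) = 1\<close>, with no factorials.\<close>

definition wedge11 :: "form1 \<Rightarrow> form1 \<Rightarrow> form2" where
  "wedge11 \<alpha> \<beta> u v = \<alpha> u * \<beta> v - \<alpha> v * \<beta> u"

definition wedge12 :: "form1 \<Rightarrow> form2 \<Rightarrow> form3" where
  "wedge12 \<alpha> \<eta> u v w = \<alpha> u * \<eta> v w - \<alpha> v * \<eta> u w + \<alpha> w * \<eta> u v"

definition dzeta :: "2 \<Rightarrow> form1" where
  "dzeta j v = v $ j"

definition del :: "(complex^2 \<Rightarrow> complex) \<Rightarrow> complex^2 \<Rightarrow> form1" where
  "del f \<zeta> v = (\<Sum>j\<in>UNIV. wirt j f \<zeta> * dzeta j v)"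

definition delbar :: "(complex^2 \<Rightarrow> complex) \<Rightarrow> complex^2 \<Rightarrow> form1" where
  "delbar f \<zeta> v = (\<Sum>j\<in>UNIV. wirt_bar j f \<zeta> * cnj (dzeta j v))"

text \<open>\<open>delbar_del f\<close> is delbar applied to the \<open>(1,0)\<close>-form
  \<open>\<Sum>\<^sub>j (\<partial>f/\<partial>\<zeta>\<^sub>j) d\<zeta>\<^sub>j\<close>; it acts on the coefficients.\<close>

definition delbar_del :: "(complex^2 \<Rightarrow> complex) \<Rightarrow> complex^2 \<Rightarrow> form2" where
  "delbar_del f \<zeta> u v = (\<Sum>j\<in>UNIV. wedge11 (delbar (wirt j f) \<zeta>) (dzeta j) u v)"

abbreviation cplx :: "(complex^2 \<Rightarrow> real) \<Rightarrow> complex^2 \<Rightarrow> complex" where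
  "cplx \<rho> \<equiv> \<lambda>\<zeta>. complex_of_real (\<rho> \<zeta>)"


section \<open>Real hypersurfaces in \<open>\<complex>\<^sup>2\<close>\<close>

definition local_defining_function :: "(complex^2) set \<Rightarrow> (complex^2) set \<Rightarrow> (complex^2 \<Rightarrow> real) \<Rightarrow> bool" where
  "local_defining_function S U \<rho> \<longleftrightarrow>
     open U \<and> smooth_on U \<rho> \<and> S \<inter> U = {\<zeta>\<in>U. \<rho> \<zeta> = 0} \<and>
     (\<forall>\<zeta>\<in>S \<inter> U. frechet_derivative \<rho> (at \<zeta>) \<noteq> (\<lambda>v. 0))"

definition defining_function :: "(complex^2) set \<Rightarrow> (complex^2) set \<Rightarrow> (complex^2 \<Rightarrow> real) \<Rightarrow> bool" where
  "defining_function S U \<rho> \<longleftrightarrow> S \<subseteq> U \<and> local_defining_function S U \<rho>"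

definition smooth_hypersurface :: "(complex^2) set \<Rightarrow> bool" where
  "smooth_hypersurface S \<longleftrightarrow> (\<forall>p\<in>S. \<exists>U \<rho>. p \<in> U \<and> local_defining_function S U \<rho>)"

definition tangent_space :: "(complex^2 \<Rightarrow> real) \<Rightarrow> complex^2 \<Rightarrow> (complex^2) set" where
  "tangent_space \<rho> \<zeta> = {v. frechet_derivative \<rho> (at \<zeta>) v = 0}"

text \<open>\<open>\<zeta>\<close> plus the maximal complex subspace of the tangent space.\<close>

definition complex_tangent_line :: "(complex^2 \<Rightarrow> real) \<Rightarrow> complex^2 \<Rightarrow> (complex^2) set" where
  "complex_tangent_line \<rho> \<zeta> =
     {z. z - \<zeta> \<in> tangent_space \<rho> \<zeta> \<and> \<i> *s (z - \<zeta>) \<in> tangent_space \<rho> \<zeta>}"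

definition levi_form :: "(complex^2 \<Rightarrow> real) \<Rightarrow> complex^2 \<Rightarrow> complex^2 \<Rightarrow> real" where
  "levi_form \<rho> \<zeta> t =
     Re (\<Sum>j\<in>UNIV. \<Sum>k\<in>UNIV. wirt_bar k (wirt j (cplx \<rho>)) \<zeta> * t $ j * cnj (t $ k))"

text \<open>The Levi form at \<open>\<zeta>\<close> is positive definite on the complex tangent space; so \<open>\<rho> < 0\<close> is
  the strongly pseudoconvex side.\<close>

definition levi_positive :: "(complex^2 \<Rightarrow> real) \<Rightarrow> complex^2 \<Rightarrow> bool" where
  "levi_positive \<rho> \<zeta> \<longleftrightarrow>
     (\<forall>t. t \<noteq> 0 \<and> t \<in> tangent_space \<rho> \<zeta> \<and> \<i> *s t \<in> tangent_space \<rho> \<zeta> \<longrightarrow> levi_form \<rho> \<zeta> t > 0)"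

definition strongly_pseudoconvex :: "(complex^2) set \<Rightarrow> bool" where
  "strongly_pseudoconvex S \<longleftrightarrow>
     (\<forall>p\<in>S. \<exists>U \<rho>. p \<in> U \<and> local_defining_function S U \<rho> \<and> levi_positive \<rho> p)"


section \<open>Strong \<open>\<complex>\<close>-convexity\<close>

definition homog :: "complex^2 \<Rightarrow> complex^3" where
  "homog z = vector [1, z $ 1, z $ 2]"

text \<open>The automorphism of \<open>\<complex>\<P>\<^sup>2\<close> given by an invertible matrix \<open>T\<close>, in the affine chart
  \<open>[1 : z\<^sub>1 : z\<^sub>2]\<close>; meaningful at the points \<open>z\<close> with \<open>(T *v homog z) $ 1 \<noteq> 0\<close>.\<close>

definition proj_map :: "complex^3^3 \<Rightarrow> complex^2 \<Rightarrow> complex^2" where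
  "proj_map T z = vector [(T *v homog z) $ 2 / (T *v homog z) $ 1, (T *v homog z) $ 3 / (T *v homog z) $ 1]"

definition proj_image :: "complex^3^3 \<Rightarrow> (complex^2) set \<Rightarrow> (complex^2) set" where
  "proj_image T S = proj_map T ` {z\<in>S. (T *v homog z) $ 1 \<noteq> 0}"

text \<open>\<open>S\<close> passes through the origin and is given near it by
  \<open>Im \<zeta>\<^sub>2 = \<alpha>|\<zeta>\<^sub>1|\<^sup>2 + Re (b \<zeta>\<^sub>1\<^sup>2) + c (Re \<zeta>\<^sub>2)\<^sup>2 + O(\<parallel>(\<zeta>\<^sub>1, Re \<zeta>\<^sub>2)\<parallel>\<^sup>3)\<close>.\<close>

definition quadratic_normal_form :: "(complex^2) set \<Rightarrow> real \<Rightarrow> complex \<Rightarrow> real \<Rightarrow> bool" where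
  "quadratic_normal_form S \<alpha> b c \<longleftrightarrow> 0 \<in> S \<and>
     (\<exists>W. \<exists>R :: complex \<times> real \<Rightarrow> real. open W \<and> 0 \<in> W \<and> R \<in> O[nhds 0](\<lambda>x. norm x ^ 3) \<and>
        S \<inter> W = {\<zeta>\<in>W. Im (\<zeta> $ 2) = \<alpha> * (cmod (\<zeta> $ 1))\<^sup>2 + Re (b * (\<zeta> $ 1)\<^sup>2) + c * (Re (\<zeta> $ 2))\<^sup>2
                              + R (\<zeta> $ 1, Re (\<zeta> $ 2))})"

text \<open>The automorphism is chosen existentially: up to positive rescaling
  and rotation of \<open>\<zeta>\<^sub>1\<close>, the quadratic form in \<open>\<zeta>\<^sub>1\<close> does not depend on it, except that
  \<open>\<zeta>\<^sub>2 \<mapsto> -\<zeta>\<^sub>2\<close> changes the sign.\<close>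

definition strongly_C_convex :: "(complex^2) set \<Rightarrow> bool" where
  "strongly_C_convex S \<longleftrightarrow>
     connected S \<and> smooth_hypersurface S \<and> strongly_pseudoconvex S \<and>
     (\<forall>p\<in>S. \<exists>T \<alpha> b c. invertible T \<and> (T *v homog p) $ 1 \<noteq> 0 \<and> proj_map T p = 0 \<and>
        quadratic_normal_form (proj_image T S) \<alpha> b c \<and>
        (\<forall>\<zeta>1. \<zeta>1 \<noteq> 0 \<longrightarrow> \<alpha> * (cmod \<zeta>1)\<^sup>2 + Re (b * \<zeta>1\<^sup>2) > 0))"


section \<open>Integration of 3-forms over a strongly pseudoconvex hypersurface\<close>

definition real_coords :: "complex^2 \<Rightarrow> real^4" where
  "real_coords v = vector [Re (v $ 1), Im (v $ 1), Re (v $ 2), Im (v $ 2)]"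

text \<open>Boundary orientation of the strongly pseudoconvex side: \<open>n\<close> is an outward vector
  and \<open>\<complex>\<^sup>2\<close> is oriented by \<open>(x\<^sub>1, y\<^sub>1, x\<^sub>2, y\<^sub>2)\<close>.\<close>

definition positively_oriented :: "(complex^2) set \<Rightarrow> complex^2 \<Rightarrow> complex^2 \<Rightarrow> complex^2 \<Rightarrow> complex^2 \<Rightarrow> bool" where
  "positively_oriented S \<zeta> v1 v2 v3 \<longleftrightarrow>
     (\<exists>U \<rho> n. \<zeta> \<in> U \<and> local_defining_function S U \<rho> \<and> levi_positive \<rho> \<zeta> \<and>
        {v1, v2, v3} \<subseteq> tangent_space \<rho> \<zeta> \<and> frechet_derivative \<rho> (at \<zeta>) n > 0 \<and>
        det (vector [real_coords n, real_coords v1, real_coords v2, real_coords v3] :: real^4^4) > 0)"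

text \<open>A smooth positively oriented local parametrisation; positivity of the orientation makes it
  an immersion.\<close>

definition oriented_chart :: "(complex^2) set \<Rightarrow> (real^3) set \<Rightarrow> (real^3 \<Rightarrow> complex^2) \<Rightarrow> bool" where
  "oriented_chart S V \<phi> \<longleftrightarrow>
     open V \<and> smooth_on V \<phi> \<and> openin (top_of_set S) (\<phi> ` V) \<and> (\<exists>\<psi>. homeomorphism V (\<phi> ` V) \<phi> \<psi>) \<and>
     (\<forall>x\<in>V. positively_oriented S (\<phi> x)
        (frechet_derivative \<phi> (at x) (axis 1 1))
        (frechet_derivative \<phi> (at x) (axis 2 1))
        (frechet_derivative \<phi> (at x) (axis 3 1)))"

definition pullback3 :: "(real^3 \<Rightarrow> complex^2) \<Rightarrow> (complex^2 \<Rightarrow> form3) \<Rightarrow> real^3 \<Rightarrow> complex" where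
  "pullback3 \<phi> \<omega> x = \<omega> (\<phi> x)
     (frechet_derivative \<phi> (at x) (axis 1 1))
     (frechet_derivative \<phi> (at x) (axis 2 1))
     (frechet_derivative \<phi> (at x) (axis 3 1))"

text \<open>The (absolutely convergent) integral of \<open>\<omega>\<close> over the oriented hypersurface \<open>S\<close>: cut \<open>S\<close> into
  countably many disjoint Borel pieces \<open>A i\<close>, each lying in the range of an oriented chart
  (possibly with empty domain), and add up the integrals of the pulled-back forms.  By the change of
  variables formula the value does not depend on the pieces and charts.  Only the values of \<open>\<omega>\<close> on
  triples of tangent vectors at points of \<open>S\<close> matter.\<close>

definition has_form_integral :: "(complex^2 \<Rightarrow> form3) \<Rightarrow> complex \<Rightarrow> (complex^2) set \<Rightarrow> bool" where
  "has_form_integral \<omega> I S \<longleftrightarrow>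
     (\<exists>(V :: nat \<Rightarrow> (real^3) set) \<phi> A.
        (\<forall>i. oriented_chart S (V i) (\<phi> i) \<and> A i \<in> sets borel \<and> A i \<subseteq> \<phi> i ` V i) \<and>
        disjoint_family A \<and> (\<Union>i. A i) = S \<and>
        (\<forall>i. set_integrable lebesgue (V i \<inter> \<phi> i -` A i) (pullback3 (\<phi> i) \<omega>)) \<and>
        summable (\<lambda>i. LINT x:(V i \<inter> \<phi> i -` A i)|lebesgue. norm (pullback3 (\<phi> i) \<omega> x)) \<and>
        (\<lambda>i. LINT x:(V i \<inter> \<phi> i -` A i)|lebesgue. pullback3 (\<phi> i) \<omega> x) sums I)"

definition form_integral :: "(complex^2) set \<Rightarrow> (complex^2 \<Rightarrow> form3) \<Rightarrow> complex" where
  "form_integral S \<omega> = (THE I. has_form_integral \<omega> I S)"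


section \<open>The Leray integral\<close>

text \<open>Where the denominator vanishes, i.e. where \<open>z\<close> lies on the complex tangent line at \<open>\<zeta>\<close>, the
  HOL convention makes the integrand 0.\<close>

definition leray_integrand ::
  "(complex^2 \<Rightarrow> real) \<Rightarrow> (complex^2 \<Rightarrow> complex) \<Rightarrow> complex^2 \<Rightarrow> complex^2 \<Rightarrow> form3" where
  "leray_integrand \<rho> f z \<zeta> v1 v2 v3 =
     f \<zeta> * (1 / (2 * of_real pi * \<i>)\<^sup>2 *
       (wedge12 (del (cplx \<rho>) \<zeta>) (delbar_del (cplx \<rho>) \<zeta>) v1 v2 v3
         / (del (cplx \<rho>) \<zeta> (\<zeta> - z))\<^sup>2))"

definition has_leray_integral ::
  "(complex^2) set \<Rightarrow> (complex^2 \<Rightarrow> real) \<Rightarrow> (complex^2 \<Rightarrow> complex) \<Rightarrow> complex^2 \<Rightarrow> complex \<Rightarrow> bool" where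
  "has_leray_integral S \<rho> f z I \<longleftrightarrow> has_form_integral (leray_integrand \<rho> f z) I S"

definition leray_integral ::
  "(complex^2) set \<Rightarrow> (complex^2 \<Rightarrow> real) \<Rightarrow> (complex^2 \<Rightarrow> complex) \<Rightarrow> complex^2 \<Rightarrow> complex" where
  "leray_integral S \<rho> f z = form_integral S (leray_integrand \<rho> f z)"


section \<open>\<open>M\<close>-admissibility and the functions \<open>w\<^sub>M\<close>\<close>

text \<open>\<open>M\<close> has the rows \<open>(c\<^sub>1, a\<^sub>1, a\<^sub>2)\<close>, \<open>(b\<^sub>1, m\<^sub>1\<^sub>1, m\<^sub>1\<^sub>2)\<close>, \<open>(b\<^sub>2, m\<^sub>2\<^sub>1, m\<^sub>2\<^sub>2)\<close>.\<close>

definition Phi :: "complex^3^3 \<Rightarrow> complex^2 \<Rightarrow> complex^2 \<Rightarrow> complex" where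
  "Phi M z w = (\<Sum>i\<in>UNIV. homog w $ i * (M *v homog z) $ i)"

definition mblock :: "complex^3^3 \<Rightarrow> complex^2^2" where
  "mblock M = vector [vector [M $ 2 $ 2, M $ 2 $ 3], vector [M $ 3 $ 2, M $ 3 $ 3]]"

definition bcol :: "complex^3^3 \<Rightarrow> complex^2" where
  "bcol M = vector [M $ 2 $ 1, M $ 3 $ 1]"

definition mu :: "(complex^2 \<Rightarrow> real) \<Rightarrow> complex^2 \<Rightarrow> complex^2" where
  "mu \<rho> \<zeta> = vector [wirt 2 (cplx \<rho>) \<zeta>, - wirt 1 (cplx \<rho>) \<zeta>]"

definition M_admissible :: "complex^3^3 \<Rightarrow> (complex^2) set \<Rightarrow> (complex^2 \<Rightarrow> real) \<Rightarrow> bool" where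
  "M_admissible M S \<rho> \<longleftrightarrow>
     (\<forall>\<zeta>\<in>S. let p = mblock M *v mu \<rho> \<zeta>; q = mblock M *v \<zeta> + bcol M in
        det (vector [vector [p $ 1, q $ 1], vector [p $ 2, q $ 2]] :: complex^2^2) \<noteq> 0)"

definition wM :: "complex^3^3 \<Rightarrow> (complex^2 \<Rightarrow> real) \<Rightarrow> complex^2 \<Rightarrow> complex^2" where
  "wM M \<rho> \<zeta> = (THE w. complex_tangent_line \<rho> \<zeta> = {z. Phi M z w = 0})"

text \<open>The differential along \<open>S\<close> of a function \<open>g\<close> on \<open>S\<close>.  A derivative within \<open>S\<close> is
  unique only on vectors tangent to \<open>S\<close>, and it is only used on those.\<close>

definition d_along :: "(complex^2) set \<Rightarrow> (complex^2 \<Rightarrow> complex) \<Rightarrow> complex^2 \<Rightarrow> form1" where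
  "d_along S g \<zeta> = frechet_derivative g (at \<zeta> within S)"

definition nuM :: "complex^3^3 \<Rightarrow> (complex^2) set \<Rightarrow> (complex^2 \<Rightarrow> real) \<Rightarrow> complex^2 \<Rightarrow> form3" where
  "nuM M S \<rho> \<zeta> v1 v2 v3 =
     (let w1 = (\<lambda>\<zeta>. wM M \<rho> \<zeta> $ 1); w2 = (\<lambda>\<zeta>. wM M \<rho> \<zeta> $ 2);
          dw1 = d_along S w1 \<zeta>; dw2 = d_along S w2 \<zeta>;
          q = mblock M *v vector [M $ 1 $ 3, - M $ 1 $ 2];
          \<theta> = (\<lambda>v. (dw1 v * q $ 1 + dw2 v * q $ 2)
                     + det (mblock M) * (w2 \<zeta> * dw1 v - w1 \<zeta> * dw2 v))
      in 1 / (2 * of_real pi * \<i>)\<^sup>2 * wedge12 \<theta> (wedge11 (dzeta 1) (dzeta 2)) v1 v2 v3)"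

end

theory Submission
  imports Defs
begin

text \<open>Write \<open>(1, w\<^sub>1, w\<^sub>2) M = (L\<^sub>1, L\<^sub>2, L\<^sub>3)\<close>.  The zero set of \<open>z \<mapsto> Phi M z w\<close> being the complex
  tangent line at \<open>\<zeta>\<close> means \<open>(L\<^sub>2, L\<^sub>3) = l (\<rho>\<^sub>1, \<rho>\<^sub>2)\<close> and \<open>Phi M z w = l \<langle>\<partial>\<rho>, z - \<zeta>\<rangle>\<close>, where
  \<open>\<rho>\<^sub>j = \<partial>\<rho>/\<partial>\<zeta>\<^sub>j\<close> and \<open>l \<noteq> 0\<close>.  The 1-form in \<open>\<nu>\<^sub>M\<close> is \<open>L\<^sub>3 dL\<^sub>2 - L\<^sub>2 dL\<^sub>3\<close>; differentiating
  \<open>L\<^sub>2 \<rho>\<^sub>2 = L\<^sub>3 \<rho>\<^sub>1\<close> along \<open>S\<close> turns it into \<open>l\<^sup>2 (\<rho>\<^sub>2 d\<rho>\<^sub>1 - \<rho>\<^sub>1 d\<rho>\<^sub>2)\<close>, and its wedge product with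
  \<open>d\<zeta>\<^sub>1 \<and> d\<zeta>\<^sub>2\<close> is \<open>l\<^sup>2\<close> times the Leray numerator.  So the two integrands agree on tangent
  vectors, including where the denominators vanish.\<close>

section \<open>Integrals as functions of the pullbacks\<close>

text \<open>The pieces and charts that witness one integral serve for the other as well, since a
  form enters only through its pullbacks on chart domains.\<close>

lemma has_form_integral_cong:
  assumes "\<And>V \<phi> x. oriented_chart S V \<phi> \<Longrightarrow> x \<in> V \<Longrightarrow> pullback3 \<phi> \<omega> x = pullback3 \<phi> \<omega>' x"
  shows "has_form_integral \<omega> I S \<longleftrightarrow> has_form_integral \<omega>' I S"
proof -
  have imp: "has_form_integral \<omega>2 I S"
    if eq: "\<And>V \<phi> x. oriented_chart S V \<phi> \<Longrightarrow> x \<in> V \<Longrightarrow> pullback3 \<phi> \<omega>1 x = pullback3 \<phi> \<omega>2 x"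
      and int: "has_form_integral \<omega>1 I S" for \<omega>1 \<omega>2
  proof -
    from int obtain V :: "nat \<Rightarrow> (real^3) set" and \<phi> A where
      ch: "\<forall>i. oriented_chart S (V i) (\<phi> i) \<and> A i \<in> sets borel \<and> A i \<subseteq> \<phi> i ` V i"
      and A: "disjoint_family A" "(\<Union>i. A i) = S"
      and 1: "\<forall>i. set_integrable lebesgue (V i \<inter> \<phi> i -` A i) (pullback3 (\<phi> i) \<omega>1)"
      and 2: "summable (\<lambda>i. LINT x:(V i \<inter> \<phi> i -` A i)|lebesgue. norm (pullback3 (\<phi> i) \<omega>1 x))"
      and 3: "(\<lambda>i. LINT x:(V i \<inter> \<phi> i -` A i)|lebesgue. pullback3 (\<phi> i) \<omega>1 x) sums I"
      unfolding has_form_integral_def by blast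
    \<comment> \<open>Outside the set the indicator is 0, so the equality holds for all
      \<open>x\<close> and can be rewritten under the integral sign.\<close>
    have e: "indicator (V i \<inter> \<phi> i -` A i) x *\<^sub>R pullback3 (\<phi> i) \<omega>1 x
           = indicator (V i \<inter> \<phi> i -` A i) x *\<^sub>R pullback3 (\<phi> i) \<omega>2 x"
      "indicator (V i \<inter> \<phi> i -` A i) x *\<^sub>R norm (pullback3 (\<phi> i) \<omega>1 x)
           = indicator (V i \<inter> \<phi> i -` A i) x *\<^sub>R norm (pullback3 (\<phi> i) \<omega>2 x)" for i x
      using eq[of "V i" "\<phi> i" x] ch by (auto simp: indicator_def)
    show ?thesis
      unfolding has_form_integral_def
      using ch A 1 2 3 unfolding set_integrable_def set_lebesgue_integral_def e by blast
  qed
  show ?thesis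
    using imp[of \<omega> \<omega>'] imp[of \<omega>' \<omega>] assms by metis
qed

section \<open>Wirtinger calculus for a real defining function\<close>

lemma frechet_derivative_cplx:
  assumes "\<rho> differentiable (at \<zeta>)"
  shows "frechet_derivative (cplx \<rho>) (at \<zeta>) v = of_real (frechet_derivative \<rho> (at \<zeta>) v)"
    and "cplx \<rho> differentiable (at \<zeta>)"
proof -
  have "(cplx \<rho> has_derivative (\<lambda>v. of_real (frechet_derivative \<rho> (at \<zeta>) v))) (at \<zeta>)"
    using assms by (intro has_derivative_of_real) (simp add: frechet_derivative_works)
  then show "frechet_derivative (cplx \<rho>) (at \<zeta>) v = of_real (frechet_derivative \<rho> (at \<zeta>) v)"
    "cplx \<rho> differentiable (at \<zeta>)"
    by (auto dest: frechet_derivative_at[symmetric] simp: differentiable_def)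
qed

lemma smooth_on_differentiable:
  assumes "smooth_on U f" "x \<in> U"
  shows "f differentiable (at x)"
    and "(\<lambda>x. frechet_derivative f (at x) v) differentiable (at x)"
proof -
  have "Ck_on (Suc (Suc 0)) U f" using assms(1) by (simp only: smooth_on_def)
  then show "f differentiable (at x)" "(\<lambda>x. frechet_derivative f (at x) v) differentiable (at x)"
    using assms(2) by auto
qed

lemma wirt_cplx_differentiable:
  assumes "open U" "smooth_on U \<rho>" "\<zeta> \<in> U"
  shows "wirt j (cplx \<rho>) differentiable (at \<zeta>)"
proof -
  let ?g = "\<lambda>\<zeta>. (of_real (frechet_derivative \<rho> (at \<zeta>) (axis j 1))
               - \<i> * of_real (frechet_derivative \<rho> (at \<zeta>) (axis j \<i>))) / 2 :: complex"
  have "(\<lambda>\<zeta>. complex_of_real (frechet_derivative \<rho> (at \<zeta>) v)) differentiable (at \<zeta>)" for v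
    using smooth_on_differentiable(2)[OF assms(2,3)] by (rule frechet_derivative_cplx(2))
  then have "?g differentiable (at \<zeta>)"
    by (intro differentiable_diff differentiable_mult differentiable_divide) auto
  then obtain g' where "(?g has_derivative g') (at \<zeta>)" by (auto simp: differentiable_def)
  \<comment> \<open>\<open>?g\<close> is written with the real derivative of \<open>\<rho>\<close>;
    it is identified with \<open>wirt\<close> where \<open>\<rho>\<close> is known to be
    differentiable, on the open set \<open>U\<close>.\<close>
  then have "(wirt j (cplx \<rho>) has_derivative g') (at \<zeta>)"
  proof (rule has_derivative_transform_within_open[OF _ assms(1,3)])
    fix y assume "y \<in> U"
    then show "?g y = wirt j (cplx \<rho>) y"
      by (simp add: wirt_def frechet_derivative_cplx(1) smooth_on_differentiable(1)[OF assms(2)])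
  qed
  then show ?thesis by (auto simp: differentiable_def)
qed

lemma frechet_derivative_eq_del_delbar:
  assumes "f differentiable (at \<zeta>)"
  shows "frechet_derivative f (at \<zeta>) v = del f \<zeta> v + delbar f \<zeta> v"
proof -
  have lin: "linear (frechet_derivative f (at \<zeta>))"
    using assms by (rule linear_frechet_derivative)
  have v: "v = (\<Sum>j\<in>UNIV. Re (v $ j) *\<^sub>R axis j 1 + Im (v $ j) *\<^sub>R axis j \<i>)"
    by (simp add: vec_eq_iff sum_2 forall_2 axis_def complex_eq_iff)
  have "frechet_derivative f (at \<zeta>) v
      = (\<Sum>j\<in>UNIV. Re (v $ j) *\<^sub>R frechet_derivative f (at \<zeta>) (axis j 1)
                  + Im (v $ j) *\<^sub>R frechet_derivative f (at \<zeta>) (axis j \<i>))"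
    by (subst v) (simp add: linear_sum[OF lin] linear_add[OF lin] linear_scale[OF lin])
  also have "\<dots> = del f \<zeta> v + delbar f \<zeta> v"
    unfolding del_def delbar_def sum.distrib[symmetric]
  proof (rule sum.cong)
    fix j :: 2
    \<comment> \<open>A real-linear map on \<complex> with values \<open>p\<close> at 1 and
      \<open>q\<close> at \<open>\<i>\<close> splits into a complex-linear and an antilinear
      part.\<close>
    have "(p - \<i> * q) / 2 * w + (p + \<i> * q) / 2 * cnj w = Re w *\<^sub>R p + Im w *\<^sub>R q" for p q w
      by (simp add: complex_eq_iff field_simps)
    then show "Re (v $ j) *\<^sub>R frechet_derivative f (at \<zeta>) (axis j 1)
                  + Im (v $ j) *\<^sub>R frechet_derivative f (at \<zeta>) (axis j \<i>)
        = wirt j f \<zeta> * dzeta j v + wirt_bar j f \<zeta> * cnj (dzeta j v)"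
      by (simp add: wirt_def wirt_bar_def dzeta_def)
  qed simp
  finally show ?thesis .
qed

text \<open>For real \<open>\<rho>\<close> the (0,1)-part of the differential is the conjugate of
  the (1,0)-part.\<close>

lemma frechet_derivative_real_eq_del:
  assumes "\<rho> differentiable (at \<zeta>)"
  shows "frechet_derivative \<rho> (at \<zeta>) v = 2 * Re (del (cplx \<rho>) \<zeta> v)"
proof -
  have "delbar (cplx \<rho>) \<zeta> v = cnj (del (cplx \<rho>) \<zeta> v)"
    by (simp add: del_def delbar_def wirt_def wirt_bar_def frechet_derivative_cplx(1)[OF assms])
  then have "of_real (frechet_derivative \<rho> (at \<zeta>) v)
      = del (cplx \<rho>) \<zeta> v + cnj (del (cplx \<rho>) \<zeta> v)"
    using frechet_derivative_eq_del_delbar[OF frechet_derivative_cplx(2)[OF assms]]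
      frechet_derivative_cplx(1)[OF assms] by simp
  then have "Re (of_real (frechet_derivative \<rho> (at \<zeta>) v))
      = Re (del (cplx \<rho>) \<zeta> v + cnj (del (cplx \<rho>) \<zeta> v))" by simp
  then show ?thesis by simp
qed

text \<open>Multiplication by \<open>\<i>\<close> turns the real part into minus the imaginary part,
  so the two real tangency conditions form one complex equation.\<close>

lemma complex_tangent_line_eq:
  assumes "\<rho> differentiable (at \<zeta>)"
  shows "complex_tangent_line \<rho> \<zeta> = {z. del (cplx \<rho>) \<zeta> (z - \<zeta>) = 0}"
proof -
  have "del (cplx \<rho>) \<zeta> (\<i> *s v) = \<i> * del (cplx \<rho>) \<zeta> v" for v
    by (simp add: del_def dzeta_def sum_distrib_left mult_ac)
  then show ?thesis
    by (auto simp: complex_tangent_line_def tangent_space_def complex_eq_iff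
        frechet_derivative_real_eq_del[OF assms] simp del: vector_ssub_ldistrib)
qed

section \<open>The function \<open>Phi\<close> and the dual coordinates \<open>wM\<close>\<close>

lemma Phi_expand: "Phi M z w =
    (\<Sum>j\<in>UNIV. (homog w v* M) $ j * homog z $ j)"
  by (simp add: Phi_def matrix_vector_mult_def vector_matrix_mult_def sum_3 algebra_simps)

text \<open>An affine function of \<open>z\<close> that vanishes at \<open>\<zeta>\<close> is
  determined by its linear coefficients, here entries 2 and 3 of
  \<open>homog w v* M\<close>.\<close>

lemma Phi_eq_mult_del:
  assumes "Phi M \<zeta> w = 0"
    and "(homog w v* M) $ 2 = l * wirt 1 (cplx \<rho>) \<zeta>" "(homog w v* M) $ 3 = l * wirt 2 (cplx \<rho>) \<zeta>"
  shows "Phi M z w = l * del (cplx \<rho>) \<zeta> (z - \<zeta>)"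
proof -
  have "Phi M z w = Phi M z w - Phi M \<zeta> w" using assms(1) by simp
  then show ?thesis
    using assms(2,3)
    by (simp add: Phi_expand sum_3 sum_2 homog_def del_def dzeta_def algebra_simps)
qed

text \<open>Cramer's rule for the two linear equations in \<open>w\<close> that put \<open>\<zeta>\<close> and \<open>\<zeta> + \<mu>\<close> on the line
  \<open>{z. Phi M z w = 0}\<close>; the determinant of the system is the one in \<open>M_admissible\<close>.\<close>

definition admissible_det :: "complex^3^3 \<Rightarrow> (complex^2 \<Rightarrow> real) \<Rightarrow> complex^2 \<Rightarrow> complex" where
  "admissible_det M \<rho> \<zeta> =
     (let p = mblock M *v mu \<rho> \<zeta>; q = mblock M *v \<zeta> + bcol M in p $ 1 * q $ 2 - q $ 1 * p $ 2)"

definition cramer_w :: "complex^3^3 \<Rightarrow> (complex^2 \<Rightarrow> real) \<Rightarrow> complex^2 \<Rightarrow> complex^2" where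
  "cramer_w M \<rho> \<zeta> =
     (let p = mblock M *v mu \<rho> \<zeta>; q = mblock M *v \<zeta> + bcol M;
          A = M $ 1 $ 2 * mu \<rho> \<zeta> $ 1 + M $ 1 $ 3 * mu \<rho> \<zeta> $ 2;
          B = M $ 1 $ 1 + M $ 1 $ 2 * \<zeta> $ 1 + M $ 1 $ 3 * \<zeta> $ 2
      in vector [(B * p $ 2 - A * q $ 2) / admissible_det M \<rho> \<zeta>,
                 (A * q $ 1 - B * p $ 1) / admissible_det M \<rho> \<zeta>])"

lemma M_admissible_iff: "M_admissible M S \<rho> \<longleftrightarrow> (\<forall>\<zeta>\<in>S. admissible_det M \<rho> \<zeta> \<noteq> 0)"
  by (simp add: M_admissible_def admissible_det_def Let_def det_2)

lemma Phi_eq_0_iff_cramer_w: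
  assumes "admissible_det M \<rho> \<zeta> \<noteq> 0"
  shows "Phi M \<zeta> w = 0 \<and> Phi M (\<zeta> + mu \<rho> \<zeta>) w = 0 \<longleftrightarrow> w = cramer_w M \<rho> \<zeta>"
proof -
  define p q A B where "p = mblock M *v mu \<rho> \<zeta>" and "q = mblock M *v \<zeta> + bcol M"
    and "A = M $ 1 $ 2 * mu \<rho> \<zeta> $ 1 + M $ 1 $ 3 * mu \<rho> \<zeta> $ 2"
    and "B = M $ 1 $ 1 + M $ 1 $ 2 * \<zeta> $ 1 + M $ 1 $ 3 * \<zeta> $ 2"
  note defs = p_def q_def A_def B_def
  define D where "D = admissible_det M \<rho> \<zeta>"
  have D: "D = p $ 1 * q $ 2 - q $ 1 * p $ 2" "D \<noteq> 0"
    using assms by (simp_all add: D_def admissible_det_def defs Let_def)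
  have 1: "Phi M \<zeta> w = B + (w $ 1 * q $ 1 + w $ 2 * q $ 2)"
    by (simp add: Phi_def homog_def matrix_vector_mult_def sum_3 sum_2 defs mblock_def bcol_def
        algebra_simps)
  have 2: "Phi M (\<zeta> + mu \<rho> \<zeta>) w = Phi M \<zeta> w + (A + (w $ 1 * p $ 1 + w $ 2 * p $ 2))"
    by (simp add: Phi_def homog_def matrix_vector_mult_def sum_3 sum_2 defs mblock_def bcol_def
        algebra_simps)
  have "Phi M \<zeta> w = 0 \<and> Phi M (\<zeta> + mu \<rho> \<zeta>) w = 0 \<longleftrightarrow>
      B + (w $ 1 * q $ 1 + w $ 2 * q $ 2) = 0 \<and> A + (w $ 1 * p $ 1 + w $ 2 * p $ 2) = 0"
    using 1 2 by auto
  also have "\<dots> \<longleftrightarrow> w $ 1 * D = B * p $ 2 - A * q $ 2 \<and> w $ 2 * D = A * q $ 1 - B * p $ 1"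
    (is "?L \<longleftrightarrow> ?R")
  proof
    assume ?L then show ?R unfolding D(1) by algebra
  next
    assume R: ?R
    \<comment> \<open>Each equation times \<open>D\<close> is a combination of those in
      \<open>?R\<close>; then \<open>D\<close> is cancelled.\<close>
    then have "D * (B + (w $ 1 * q $ 1 + w $ 2 * q $ 2)) = 0"
      "D * (A + (w $ 1 * p $ 1 + w $ 2 * p $ 2)) = 0"
      unfolding D(1) by algebra+
    then show ?L using D(2) by simp
  qed
  also have "\<dots> \<longleftrightarrow> w = cramer_w M \<rho> \<zeta>"
    using D(2) by (simp add: vec_eq_iff forall_2 cramer_w_def Let_def defs[symmetric]
        D_def[symmetric] eq_divide_eq)
  finally show ?thesis .
qed

text \<open>As \<open>del\<close> annihilates \<open>mu\<close>, both \<open>\<zeta>\<close> and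
  \<open>\<zeta> + mu \<rho> \<zeta>\<close> lie on the tangent line. These two points determine
  \<open>w\<close>, which resolves the definite description, and they make the linear part of
  \<open>Phi\<close> proportional to \<open>del\<close>.\<close>

lemma wM_properties:
  assumes "invertible M" "admissible_det M \<rho> \<zeta> \<noteq> 0" and \<rho>: "\<rho> differentiable (at \<zeta>)"
    "frechet_derivative \<rho> (at \<zeta>) \<noteq> (\<lambda>v. 0)"
  shows "wM M \<rho> \<zeta> = cramer_w M \<rho> \<zeta>"
    and "\<exists>l. l \<noteq> 0 \<and> (homog (wM M \<rho> \<zeta>) v* M) $ 2 = l * wirt 1 (cplx \<rho>) \<zeta> \<and>
               (homog (wM M \<rho> \<zeta>) v* M) $ 3 = l * wirt 2 (cplx \<rho>) \<zeta> \<and>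
               (\<forall>z. Phi M z (wM M \<rho> \<zeta>) = l * del (cplx \<rho>) \<zeta> (z - \<zeta>))"
proof -
  define w where "w = cramer_w M \<rho> \<zeta>"
  define L where "L = homog w v* M"
  define r1 r2 where "r1 = wirt 1 (cplx \<rho>) \<zeta>" and "r2 = wirt 2 (cplx \<rho>) \<zeta>"
  have r: "r1 \<noteq> 0 \<or> r2 \<noteq> 0"
  proof (rule ccontr)
    assume "\<not> ?thesis"
    then have "del (cplx \<rho>) \<zeta> v = 0" for v by (simp add: del_def sum_2 r1_def r2_def)
    then show False using \<rho> by (simp add: frechet_derivative_real_eq_del fun_eq_iff)
  qed
  have Phi0: "Phi M \<zeta> w = 0" "Phi M (\<zeta> + mu \<rho> \<zeta>) w = 0"
    using Phi_eq_0_iff_cramer_w[OF assms(2)] w_def by auto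
  have Phi0': "L $ 1 + L $ 2 * \<zeta> $ 1 + L $ 3 * \<zeta> $ 2 = 0"
    using Phi0(1) unfolding Phi_expand L_def[symmetric]
    by (simp add: homog_def sum_3)
  have "Phi M (\<zeta> + mu \<rho> \<zeta>) w - Phi M \<zeta> w = 0" using Phi0 by simp
  then have proportional: "L $ 2 * r2 - L $ 3 * r1 = 0"
    unfolding Phi_expand L_def[symmetric]
    by (simp add: homog_def mu_def sum_3 r1_def[symmetric] r2_def[symmetric] algebra_simps)
  \<comment> \<open>The quotient is taken at a nonzero Wirtinger derivative;
    \<open>proportional\<close> then covers the other entry.\<close>
  define l where "l = (if r1 \<noteq> 0 then L $ 2 / r1 else L $ 3 / r2)"
  have l: "L $ 2 = l * r1" "L $ 3 = l * r2"
    using r proportional by (auto simp: l_def field_simps)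
  have "l \<noteq> 0"
  proof
    assume "l = 0"
    \<comment> \<open>Entry 1 vanishes too, because \<open>Phi\<close> is 0 at
      \<open>\<zeta>\<close>. Inverting \<open>M\<close> then contradicts the leading 1 of
      \<open>homog w\<close>.\<close>
    then have "L = 0" using l Phi0' by (simp add: vec_eq_iff forall_3)
    obtain N where "M ** N = mat 1" using assms(1) by (auto simp: invertible_def)
    then have "homog w = L v* N"
      by (simp add: L_def vector_matrix_mul_assoc)
    then have "homog w = 0" using \<open>L = 0\<close> by simp
    then show False by (simp add: homog_def vec_eq_iff forall_3)
  qed
  have Phi: "Phi M z w = l * del (cplx \<rho>) \<zeta> (z - \<zeta>)" for z
    using Phi_eq_mult_del[OF Phi0(1)] l by (simp add: L_def r1_def r2_def)
  have line: "complex_tangent_line \<rho> \<zeta> = {z. Phi M z w = 0}"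
    using \<open>l \<noteq> 0\<close> by (simp add: complex_tangent_line_eq[OF \<rho>(1)] Phi)
  have "wM M \<rho> \<zeta> = w" unfolding wM_def
  proof (rule the_equality)
    show "complex_tangent_line \<rho> \<zeta> = {z. Phi M z w = 0}" by (rule line)
  next
    fix w' assume "complex_tangent_line \<rho> \<zeta> = {z. Phi M z w' = 0}"
    then have "{z. Phi M z w' = 0} = {z. Phi M z w = 0}" using line by simp
    then have "Phi M \<zeta> w' = 0 \<and> Phi M (\<zeta> + mu \<rho> \<zeta>) w' = 0" using Phi0 by blast
    then show "w' = w" unfolding Phi_eq_0_iff_cramer_w[OF assms(2)] w_def .
  qed
  then show "wM M \<rho> \<zeta> = cramer_w M \<rho> \<zeta>"
    "\<exists>l. l \<noteq> 0 \<and> (homog (wM M \<rho> \<zeta>) v* M) $ 2 = l * wirt 1 (cplx \<rho>) \<zeta> \<and>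
         (homog (wM M \<rho> \<zeta>) v* M) $ 3 = l * wirt 2 (cplx \<rho>) \<zeta> \<and>
         (\<forall>z. Phi M z (wM M \<rho> \<zeta>) = l * del (cplx \<rho>) \<zeta> (z - \<zeta>))"
    using \<open>l \<noteq> 0\<close> l Phi w_def by (auto simp: L_def r1_def r2_def)
qed

section \<open>Derivatives along the hypersurface and in charts\<close>

lemma cramer_w_differentiable:
  assumes "\<And>j. wirt j (cplx \<rho>) differentiable (at \<zeta>)" "admissible_det M \<rho> \<zeta> \<noteq> 0"
  shows "(\<lambda>\<zeta>. cramer_w M \<rho> \<zeta> $ k) differentiable (at \<zeta>)"
proof -
  have nth: "(\<lambda>\<zeta>::complex^2. \<zeta> $ j) differentiable (at \<zeta>)" for j
    by (rule bounded_linear_imp_differentiable) (rule bounded_linear_vec_nth)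
  have mu: "(\<lambda>\<zeta>. mu \<rho> \<zeta> $ j) differentiable (at \<zeta>)" for j
    using exhaust_2[of j] assms(1) by (auto simp: mu_def)
  have p: "(\<lambda>\<zeta>. (mblock M *v mu \<rho> \<zeta>) $ j) differentiable (at \<zeta>)" for j
    unfolding matrix_vector_mult_def sum_2 by (simp add: mu)
  have q: "(\<lambda>\<zeta>. (mblock M *v \<zeta> + bcol M) $ j) differentiable (at \<zeta>)" for j
    unfolding matrix_vector_mult_def sum_2 by (simp add: nth)
  have D: "admissible_det M \<rho> differentiable (at \<zeta>)"
    using p q unfolding admissible_det_def[abs_def] Let_def
    by (intro differentiable_diff differentiable_mult)
  have "k = 1 \<or> k = 2" by (rule exhaust_2)
  then show ?thesis
    unfolding cramer_w_def Let_def
    using D assms(2) p q mu nth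
    by (elim disjE) (auto intro!: derivative_intros)
qed

lemma oriented_chart_differentiable:
  assumes "oriented_chart S V \<phi>" "x \<in> V"
  shows "(\<phi> has_derivative frechet_derivative \<phi> (at x)) (at x)"
  using assms smooth_on_differentiable(1) frechet_derivative_works
  unfolding oriented_chart_def by blast

lemma oriented_chart_subset: "oriented_chart S V \<phi> \<Longrightarrow> \<phi> ` V \<subseteq> S"
  unfolding oriented_chart_def by (meson openin_imp_subset)

text \<open>A derivative within \<open>S\<close> is ambiguous off the tangent directions; composing
  with a chart moves to an open set of \<open>real^3\<close>, where derivatives are unique.\<close>

lemma d_along_chart:
  assumes "oriented_chart S V \<phi>" "x \<in> V" "g differentiable (at (\<phi> x) within S)"
  shows "((\<lambda>x. g (\<phi> x)) has_derivative (\<lambda>h. d_along S g (\<phi> x) (frechet_derivative \<phi> (at x) h))) (at x)"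
proof -
  have "(g has_derivative d_along S g (\<phi> x)) (at (\<phi> x) within S)"
    using assms(3) unfolding d_along_def by (simp add: frechet_derivative_works)
  then have "(g has_derivative d_along S g (\<phi> x)) (at (\<phi> x) within \<phi> ` V)"
    using oriented_chart_subset[OF assms(1)] by (rule has_derivative_subset)
  moreover have "(\<phi> has_derivative frechet_derivative \<phi> (at x)) (at x within V)"
    using oriented_chart_differentiable[OF assms(1,2)] by (rule has_derivative_at_withinI)
  ultimately have "((\<lambda>x. g (\<phi> x)) has_derivative
      (\<lambda>h. d_along S g (\<phi> x) (frechet_derivative \<phi> (at x) h))) (at x within V)"
    using has_derivative_in_compose[of \<phi> _ x V g] by simp
  moreover have "open V" using assms(1) by (simp add: oriented_chart_def)
  ultimately show ?thesis using assms(2) at_within_open by metis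
qed

text \<open>Wedging with \<open>d\<zeta>\<^sub>1 \<and> d\<zeta>\<^sub>2\<close> annihilates the \<open>(1,0)\<close>-part of the differentials of the \<open>\<partial>\<rho>/\<partial>\<zeta>\<^sub>j\<close>.\<close>

lemma wedge_del_delbar_del:
  fixes f :: "complex^2 \<Rightarrow> complex"
  assumes "\<And>j. wirt j f differentiable (at \<zeta>)"
  shows "wedge12 (del f \<zeta>) (delbar_del f \<zeta>) u v w =
    wedge12 (\<lambda>h. wirt 2 f \<zeta> * frechet_derivative (wirt 1 f) (at \<zeta>) h
               - wirt 1 f \<zeta> * frechet_derivative (wirt 2 f) (at \<zeta>) h)
      (wedge11 (dzeta 1) (dzeta 2)) u v w"
  unfolding frechet_derivative_eq_del_delbar[OF assms]
  by (simp add: wedge12_def wedge11_def delbar_del_def sum_2 del_def[of _ _ u] del_def[of _ _ v]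
      del_def[of _ _ w] algebra_simps)

section \<open>Equality of the two integrands in a chart\<close>

lemma leray_pullback:
  assumes "invertible M" "defining_function S U \<rho>" "M_admissible M S \<rho>"
    and ch: "oriented_chart S V \<phi>" "x \<in> V"
  shows "pullback3 \<phi> (leray_integrand \<rho> f z) x =
    pullback3 \<phi> (\<lambda>\<zeta> v1 v2 v3. f \<zeta> * (nuM M S \<rho> \<zeta> v1 v2 v3 / (Phi M z (wM M \<rho> \<zeta>))\<^sup>2)) x"
proof -
  let ?r = "\<lambda>j. wirt j (cplx \<rho>)" and ?d\<phi> = "frechet_derivative \<phi> (at x)"
  have U: "open U" "smooth_on U \<rho>" "S \<subseteq> U"
    and nz: "\<And>\<zeta>. \<zeta> \<in> S \<Longrightarrow> frechet_derivative \<rho> (at \<zeta>) \<noteq> (\<lambda>v. 0)"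
    using assms(2) by (auto simp: defining_function_def local_defining_function_def)
  have det: "admissible_det M \<rho> \<zeta> \<noteq> 0" if "\<zeta> \<in> S" for \<zeta>
    using assms(3) that by (simp add: M_admissible_iff)
  have diff: "\<rho> differentiable (at \<zeta>)" "?r j differentiable (at \<zeta>)" if "\<zeta> \<in> S" for \<zeta> j
    using that U smooth_on_differentiable(1) wirt_cplx_differentiable by blast+
  have wM: "wM M \<rho> \<zeta> = cramer_w M \<rho> \<zeta>" if "\<zeta> \<in> S" for \<zeta>
    using wM_properties(1)[OF assms(1)] det diff(1) nz that by blast
  have \<phi>S: "\<phi> y \<in> S" if "y \<in> V" for y
    using oriented_chart_subset[OF ch(1)] that by blast
  define \<zeta> where "\<zeta> = \<phi> x"
  have \<zeta>: "\<zeta> \<in> S" using \<phi>S ch(2) by (simp add: \<zeta>_def)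
  define w where "w k = (\<lambda>\<zeta>. wM M \<rho> \<zeta> $ k)" for k
  define dw where "dw k h = d_along S (w k) \<zeta> (?d\<phi> h)" for k h
  define dr where "dr j h = frechet_derivative (?r j) (at \<zeta>) (?d\<phi> h)" for j h
  have "w k differentiable (at \<zeta> within S)" for k
  proof -
    have "(\<lambda>\<zeta>. cramer_w M \<rho> \<zeta> $ k) differentiable (at \<zeta> within S)"
      using cramer_w_differentiable[OF diff(2)[OF \<zeta>] det[OF \<zeta>]]
      by (rule differentiable_at_withinI)
    \<comment> \<open>The agreement of \<open>wM\<close> with \<open>cramer_w\<close> is available
      on \<open>S\<close>, so differentiability is transferred within \<open>S\<close>.\<close>
    then show ?thesis
      using \<zeta> wM unfolding w_def
      unfolding differentiable_def by (metis (no_types, lifting) has_derivative_transform)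
  qed
  then have dw: "((\<lambda>y. w k (\<phi> y)) has_derivative dw k) (at x)" for k
    using d_along_chart[OF ch] unfolding dw_def \<zeta>_def by simp
  have dr: "((\<lambda>y. ?r j (\<phi> y)) has_derivative dr j) (at x)" for j
  proof -
    have "(?r j has_derivative frechet_derivative (?r j) (at \<zeta>)) (at (\<phi> x))"
      using diff(2)[OF \<zeta>] by (simp add: frechet_derivative_works \<zeta>_def)
    then show ?thesis
      using oriented_chart_differentiable[OF ch] has_derivative_compose
      unfolding dr_def by blast
  qed
  define m where "m j k = M $ j $ k" for j k :: 3
  let ?L = "\<lambda>j y. m 1 j + m 2 j * w 1 (\<phi> y) + m 3 j * w 2 (\<phi> y)"
  let ?dL = "\<lambda>j h. m 2 j * dw 1 h + m 3 j * dw 2 h"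
  have dL: "(?L j has_derivative ?dL j) (at x)" for j
    by (auto intro!: derivative_eq_intros dw)
  have L: "(homog (wM M \<rho> (\<phi> y)) v* M) $ j = ?L j y" for j y
    by (simp add: vector_matrix_mult_def sum_3 homog_def w_def m_def mult_ac)
  \<comment> \<open>The factor \<open>l\<close> may vary with \<open>y\<close>, and no regularity of
    it is established; the relation differentiated below eliminates it.\<close>
  have proportional: "\<exists>l. l \<noteq> 0 \<and> ?L 2 y = l * ?r 1 (\<phi> y) \<and> ?L 3 y = l * ?r 2 (\<phi> y) \<and>
      (\<forall>z. Phi M z (wM M \<rho> (\<phi> y)) = l * del (cplx \<rho>) (\<phi> y) (z - \<phi> y))" if "y \<in> V" for y
    using wM_properties(2)[OF assms(1) det diff(1) nz, OF \<phi>S \<phi>S \<phi>S, OF that that that]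
    unfolding L .
  obtain l where l: "l \<noteq> 0" "?L 2 x = l * ?r 1 \<zeta>" "?L 3 x = l * ?r 2 \<zeta>"
    "\<And>z. Phi M z (wM M \<rho> \<zeta>) = l * del (cplx \<rho>) \<zeta> (z - \<zeta>)"
    using proportional[OF ch(2)] unfolding \<zeta>_def by blast
  have "((\<lambda>y. ?L 2 y * ?r 2 (\<phi> y) - ?L 3 y * ?r 1 (\<phi> y)) has_derivative
      (\<lambda>h. (?L 2 x * dr 2 h + ?dL 2 h * ?r 2 (\<phi> x))
        - (?L 3 x * dr 1 h + ?dL 3 h * ?r 1 (\<phi> x)))) (at x)"
    by (intro has_derivative_diff has_derivative_mult dL dr)
  \<comment> \<open>The relation holds identically on the open set \<open>V\<close>, so its
    product-rule derivative is 0.\<close>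
  moreover have "((\<lambda>y. ?L 2 y * ?r 2 (\<phi> y) - ?L 3 y * ?r 1 (\<phi> y)) has_derivative (\<lambda>h. 0)) (at x)"
  proof (rule has_derivative_transform_within_open[OF has_derivative_const _ ch(2)])
    show "open V" using ch(1) by (simp add: oriented_chart_def)
    show "0 = ?L 2 y * ?r 2 (\<phi> y) - ?L 3 y * ?r 1 (\<phi> y)" if "y \<in> V" for y
      using proportional[OF that] by auto
  qed
  ultimately have "(\<lambda>h. (?L 2 x * dr 2 h + ?dL 2 h * ?r 2 (\<phi> x))
        - (?L 3 x * dr 1 h + ?dL 3 h * ?r 1 (\<phi> x)))
      = (\<lambda>h. 0)"
    by (rule has_derivative_unique)
  then have rel: "l * ?r 1 \<zeta> * dr 2 h + ?dL 2 h * ?r 2 \<zeta> = l * ?r 2 \<zeta> * dr 1 h + ?dL 3 h * ?r 1 \<zeta>" for h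
    unfolding l(2,3) \<zeta>_def by (metis (no_types, lifting) eq_iff_diff_eq_0)
  let ?q = "mblock M *v vector [M $ 1 $ 3, - M $ 1 $ 2]"
  let ?\<theta> = "\<lambda>v. (d_along S (w 1) \<zeta> v * ?q $ 1 + d_along S (w 2) \<zeta> v * ?q $ 2)
     + det (mblock M) * (w 2 \<zeta> * d_along S (w 1) \<zeta> v - w 1 \<zeta> * d_along S (w 2) \<zeta> v)"
  let ?\<eta> = "\<lambda>v. ?r 2 \<zeta> * frechet_derivative (?r 1) (at \<zeta>) v - ?r 1 \<zeta> * frechet_derivative (?r 2) (at \<zeta>) v"
  have \<theta>: "?\<theta> (?d\<phi> h) = l\<^sup>2 * ?\<eta> (?d\<phi> h)" for h
  proof -
    \<comment> \<open>The terms in \<open>w 1 * dw 1\<close> and \<open>w 2 * dw 2\<close> cancel;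
      the mixed ones carry \<open>det (mblock M)\<close>, and the constants of \<open>?L 3\<close>
      and \<open>?L 2\<close> give \<open>?q\<close>.\<close>
    have "?\<theta> (?d\<phi> h) = ?L 3 x * ?dL 2 h - ?L 2 x * ?dL 3 h"
      by (simp add: dw_def mblock_def det_2 matrix_vector_mult_def sum_2 m_def \<zeta>_def algebra_simps)
    also have "\<dots> = l * (?dL 2 h * ?r 2 \<zeta> - ?dL 3 h * ?r 1 \<zeta>)"
      unfolding l(2,3) by (simp add: algebra_simps)
    also have "?dL 2 h * ?r 2 \<zeta> - ?dL 3 h * ?r 1 \<zeta> = l * (?r 2 \<zeta> * dr 1 h - ?r 1 \<zeta> * dr 2 h)"
      using rel[of h] by (simp add: algebra_simps)
    finally show ?thesis by (simp add: dr_def power2_eq_square mult.assoc)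
  qed
  have wedge: "wedge12 ?\<theta> (wedge11 (dzeta 1) (dzeta 2)) (?d\<phi> h1) (?d\<phi> h2) (?d\<phi> h3)
      = l\<^sup>2 * wedge12 (del (cplx \<rho>) \<zeta>) (delbar_del (cplx \<rho>) \<zeta>) (?d\<phi> h1) (?d\<phi> h2) (?d\<phi> h3)" for h1 h2 h3
    unfolding wedge_del_delbar_del[OF diff(2)[OF \<zeta>]]
    unfolding wedge12_def \<theta> by (simp add: algebra_simps)
  \<comment> \<open>The two denominators use opposite differences of \<open>z\<close> and
    \<open>\<zeta>\<close>; squaring removes the sign.\<close>
  have neg: "del (cplx \<rho>) \<zeta> (\<zeta> - z) = - del (cplx \<rho>) \<zeta> (z - \<zeta>)"
    by (simp add: del_def dzeta_def sum_negf[symmetric] algebra_simps)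
  have Phi: "(Phi M z (wM M \<rho> \<zeta>))\<^sup>2 = l\<^sup>2 * (del (cplx \<rho>) \<zeta> (\<zeta> - z))\<^sup>2"
    unfolding neg l(4) by (simp add: power_mult_distrib)
  \<comment> \<open>Only \<open>l \<noteq> 0\<close> is needed to cancel \<open>l\<^sup>2\<close>,
    so a vanishing remaining denominator makes both sides 0 alike.\<close>
  show ?thesis
    using l(1)
    unfolding pullback3_def leray_integrand_def \<zeta>_def[symmetric] Phi nuM_def Let_def w_def[symmetric] wedge
    by simp
qed

theorem proposition4p30:
  fixes M :: "complex^3^3" and S U :: "(complex^2) set" and \<rho> :: "complex^2 \<Rightarrow> real"
    and f :: "complex^2 \<Rightarrow> complex" and z :: "complex^2"
  assumes "invertible M"
    and "strongly_C_convex S"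
    and "defining_function S U \<rho>"
    and "M_admissible M S \<rho>"
  shows "(\<forall>I. has_leray_integral S \<rho> f z I \<longleftrightarrow>
            has_form_integral
              (\<lambda>\<zeta> v1 v2 v3. f \<zeta> * (nuM M S \<rho> \<zeta> v1 v2 v3 / (Phi M z (wM M \<rho> \<zeta>))\<^sup>2)) I S) \<and>
         leray_integral S \<rho> f z =
           form_integral S
             (\<lambda>\<zeta> v1 v2 v3. f \<zeta> * (nuM M S \<rho> \<zeta> v1 v2 v3 / (Phi M z (wM M \<rho> \<zeta>))\<^sup>2))"
  \<comment> \<open>Equivalence for every \<open>I\<close> also equates the two definite
    descriptions, whether or not a value exists.\<close>
  unfolding has_leray_integral_def leray_integral_def form_integral_def
  using has_form_integral_cong[OF leray_pullback[OF assms(1,3,4)]] by simp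

end
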